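(* There is a positive constant $C$ such that $R(f)\,2^{-\deg(f)}\leq C$ for every Boolean function $f:\{0,1\}^n\to\{0,1\}$ (for every $n$). Consequently $C_d\leq C$ for all integers $d\geq 0$, and in particular $C^*=\lim_{d\to\infty}C_d$ is finite.
   Context: Every Boolean function $f:\{0,1\}^n\to\{0,1\}$ has a unique multilinear representation $f=\sum_{S\subseteq[n]}a_S\prod_{i\in S}x_i$ over $\mathbb{R}$ agreeing with $f$ on $\{0,1\}^n$; $\deg(f)$ is the degree of this representation. A variable $x_i$ is relevant for $f$ if it appears in some monomial with nonzero coefficient $a_S$; $R(f)$ is the number of relevant variables of $f$. $R_d$ is the maximum of $R(f)$ over all Boolean functions $f$ of degree at most $d$, and $C_d=R_d2^{-d}$. The sequence $C_d$ is nondecreasing in $d$, and $C^*$ denotes its (a priori possibly infinite) limit. *)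

theory Defs
  imports Complex_Main
begin

text \<open>A Boolean function on n variables is represented as f :: nat set => bool, where an
input x in {0,1}^n is identified with the set of indices i < n with x_i = 1 (only inputs
x \<subseteq> {..<n} matter). The monomial prod_{i in S} x_i equals 1 iff S \<subseteq> x.\<close>

definition mlcoef :: "nat \<Rightarrow> (nat set \<Rightarrow> bool) \<Rightarrow> nat set \<Rightarrow> real" where
  "mlcoef n f = (THE a. (\<forall>S. \<not> S \<subseteq> {..<n} \<longrightarrow> a S = 0) \<and>
                        (\<forall>x. x \<subseteq> {..<n} \<longrightarrow> of_bool (f x) = (\<Sum>S\<in>Pow x. a S)))"

definition bdeg :: "nat \<Rightarrow> (nat set \<Rightarrow> bool) \<Rightarrow> nat" where
  "bdeg n f = Max (insert 0 {card S | S. S \<subseteq> {..<n} \<and> mlcoef n f S \<noteq> 0})"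

definition relevant_vars :: "nat \<Rightarrow> (nat set \<Rightarrow> bool) \<Rightarrow> nat set" where
  "relevant_vars n f = \<Union> {S. S \<subseteq> {..<n} \<and> mlcoef n f S \<noteq> 0}"

definition Rf :: "nat \<Rightarrow> (nat set \<Rightarrow> bool) \<Rightarrow> nat" where
  "Rf n f = card (relevant_vars n f)"

definition Rdeg :: "nat \<Rightarrow> real" where
  "Rdeg d = Sup {real (Rf n f) | n f. bdeg n f \<le> d}"

definition Cdeg :: "nat \<Rightarrow> real" where
  "Cdeg d = Rdeg d / 2 ^ d"

end

theory Submission
  imports Defs "HOL-Computational_Algebra.Polynomial"
begin

text \<open>Give each relevant variable the weight \<open>2\<close> to the power minus the largest degree of a monomial
  containing it; the total weight bounds \<open>R(f) 2\<close> to the power \<open>- deg(f)\<close>. Fixing a variable to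
  \<open>0\<close> and to \<open>1\<close> and averaging does not decrease the weights of the other variables. Hence, if a
  set \<open>H\<close> of variables meets all monomials of maximal degree \<open>d\<close>, fixing the variables of \<open>H\<close>
  lowers the degree at a cost of at most \<open>|H| / 2\<^sup>d\<close>. The union of a maximal family of disjoint
  monomials of degree \<open>d\<close> is such an \<open>H\<close>. Each of these monomials contains a block to which \<open>f\<close>
  is sensitive at the zero input, so a Markov-type inequality at the endpoint of an interval bounds
  their number by \<open>4 d\<^sup>2\<close>. Thus \<open>|H| \<le> 4 d\<^sup>3\<close>, and the total cost over all degrees converges.\<close>

section \<open>Coefficients of the multilinear representation\<close>

text \<open>Moebius inversion over the subset lattice. No ambient set of variables enters, so the
  same \<open>coef\<close> serves \<open>f\<close>, its restrictions and its renamings. The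
  truncated subtraction is exact for finite \<open>S\<close>.\<close>

definition coef :: "('a set \<Rightarrow> bool) \<Rightarrow> 'a set \<Rightarrow> real" where
  "coef f S = (\<Sum>T\<in>Pow S. (-1) ^ (card S - card T) * of_bool (f T))"

lemma sum_coef:
  assumes "finite x"
  shows "(\<Sum>S\<in>Pow x. coef f S) = of_bool (f x)"
proof -
  define F :: "'a set \<Rightarrow> real" where "F = (\<lambda>S. of_bool (f S))"
  \<comment> \<open>The symmetric form of inclusion-exclusion puts the sign
    \<open>(-1) ^ card T\<close> in both directions, so \<open>coef\<close> enters it multiplied by
    that sign; the two signs cancel at the end.\<close>
  have "F x = (\<Sum>T\<in>Pow x. (-1) ^ card T * ((-1) ^ card T * coef f T))"
  proof (rule inclusion_exclusion_symmetric[OF _ assms])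
    fix S :: "'a set" assume "finite S"
    have "(-1) ^ card S * coef f S = (\<Sum>T\<in>Pow S. (-1) ^ (card S + (card S - card T)) * F T)"
      by (simp add: coef_def F_def sum_distrib_left power_add mult.assoc)
    also have "\<dots> = (\<Sum>T\<in>Pow S. (-1) ^ card T * F T)"
    proof (rule sum.cong)
      fix T assume "T \<in> Pow S"
      hence "card T \<le> card S" using \<open>finite S\<close> by (simp add: card_mono)
      hence "(card S + (card S - card T)) + card T = 2 * card S" by simp
      hence "even (card S + (card S - card T)) = even (card T)"
        by (metis dvd_triv_left even_add)
      thus "(-1) ^ (card S + (card S - card T)) * F T = (-1) ^ card T * F T"
        by (simp add: minus_one_power_iff)
    qed simp
    finally show "(-1) ^ card S * coef f S = (\<Sum>T\<in>Pow S. (-1) ^ card T * F T)" .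
  qed
  thus ?thesis by (simp add: F_def flip: mult.assoc power_add)
qed

text \<open>The equation at \<open>x = S\<close> determines \<open>c S\<close> once all proper
  subsets are settled. Coefficients of derived functions are found below by guessing them and
  checking subset sums.\<close>

lemma coef_unique:
  assumes "finite V" "\<And>x. x \<subseteq> V \<Longrightarrow> (\<Sum>S\<in>Pow x. c S) = of_bool (f x)" "S \<subseteq> V"
  shows "c S = coef f S"
proof -
  have "finite S" using assms finite_subset by blast
  thus ?thesis using \<open>S \<subseteq> V\<close>
  proof (induction S rule: finite_psubset_induct)
    case (psubset S)
    have "c S + sum c (Pow S - {S}) = coef f S + sum (coef f) (Pow S - {S})"
      using assms(2)[OF psubset.prems] sum_coef[OF psubset.hyps, of f] psubset.hyps
      by (simp add: sum.remove[of "Pow S" S])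
    moreover have "sum c (Pow S - {S}) = sum (coef f) (Pow S - {S})"
      using psubset by (intro sum.cong) auto
    ultimately show ?case by simp
  qed
qed

lemma coef_empty: "coef f {} = of_bool (f {})"
  by (simp add: coef_def)

section \<open>Restricting one variable to a constant\<close>

lemma coef_restrict0:
  assumes "finite S"
  shows "coef (\<lambda>x. f (x - {j})) S = (if j \<in> S then 0 else coef f S)"
proof (rule coef_unique[symmetric, OF assms _ order.refl])
  fix x assume "x \<subseteq> S"
  hence x: "finite x" using assms finite_subset by blast
  have "(\<Sum>T\<in>Pow x. if j \<in> T then 0 else coef f T) = (\<Sum>T\<in>Pow (x - {j}). coef f T)"
    using x by (intro sum.mono_neutral_cong_right) auto
  thus "(\<Sum>T\<in>Pow x. if j \<in> T then 0 else coef f T) = of_bool (f (x - {j}))"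
    using x by (simp add: sum_coef)
qed

text \<open>Setting variable \<open>j\<close> to 1 merges the monomials \<open>S\<close> and
  \<open>insert j S\<close>. In the check, the subsets of \<open>insert j x\<close> are split by
  membership of \<open>j\<close>.\<close>

lemma coef_restrict1:
  assumes "finite S"
  shows "coef (\<lambda>x. f (insert j x)) S = (if j \<in> S then 0 else coef f S + coef f (insert j S))"
proof (rule coef_unique[symmetric, OF assms _ order.refl])
  fix x assume "x \<subseteq> S"
  hence x: "finite x" using assms finite_subset by blast
  let ?P = "Pow (x - {j})"
  have inj: "inj_on (insert j) ?P" by (auto simp: inj_on_def)
  have "(\<Sum>T\<in>Pow x. if j \<in> T then 0 else coef f T + coef f (insert j T))
      = (\<Sum>T\<in>?P. coef f T + coef f (insert j T))"
    using x by (intro sum.mono_neutral_cong_right) auto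
  also have "\<dots> = sum (coef f) ?P + sum (coef f) (insert j ` ?P)"
    using inj by (simp add: sum.distrib sum.reindex)
  also have "\<dots> = sum (coef f) (?P \<union> insert j ` ?P)"
    using x by (intro sum.union_disjoint[symmetric]) auto
  also have "?P \<union> insert j ` ?P = Pow (insert j x)"
    using Pow_insert[of j "x - {j}"] by simp
  finally show "(\<Sum>T\<in>Pow x. if j \<in> T then 0 else coef f T + coef f (insert j T))
      = of_bool (f (insert j x))"
    using x by (simp add: sum_coef)
qed

definition supp :: "'a set \<Rightarrow> ('a set \<Rightarrow> bool) \<Rightarrow> 'a set set" where
  "supp V f = {S. S \<subseteq> V \<and> coef f S \<noteq> 0}"

lemma finite_supp: "finite V \<Longrightarrow> finite (supp V f)"
  by (rule finite_subset[of _ "Pow V"]) (auto simp: supp_def)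

lemma finite_mem_supp: "finite V \<Longrightarrow> S \<in> supp V f \<Longrightarrow> finite S"
  by (auto simp: supp_def intro: finite_subset)

lemma supp_restrict0:
  assumes "finite V" "S \<in> supp V (\<lambda>x. f (x - {j}))"
  shows "j \<notin> S" "S \<in> supp V f"
  using assms finite_mem_supp[OF assms] by (auto simp: supp_def coef_restrict0 split: if_splits)

lemma supp_restrict1:
  assumes "finite V" "j \<in> V" "S \<in> supp V (\<lambda>x. f (insert j x))"
  shows "j \<notin> S" "S \<in> supp V f \<or> insert j S \<in> supp V f"
  using assms finite_mem_supp[OF assms(1,3)] by (auto simp: supp_def coef_restrict1 split: if_splits)

text \<open>The coefficients of \<open>f\<close> at \<open>S - {j}\<close> and
  \<open>insert j S\<close> are linear combinations of those of the two restrictions at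
  \<open>S - {j}\<close>. Hence a variable other than \<open>j\<close> that is relevant for
  \<open>f\<close> survives in some restriction.\<close>

lemma mem_supp_imp_restrict:
  assumes "finite V" "S \<in> supp V f"
  shows "S - {j} \<in> supp V (\<lambda>x. f (x - {j})) \<or> S - {j} \<in> supp V (\<lambda>x. f (insert j x))"
proof (rule ccontr)
  have S: "S - {j} \<subseteq> V" "finite (S - {j})" "coef f S \<noteq> 0"
    using assms finite_mem_supp[OF assms] by (auto simp: supp_def)
  assume "\<not> ?thesis"
  hence "coef (\<lambda>x. f (x - {j})) (S - {j}) = 0" "coef (\<lambda>x. f (insert j x)) (S - {j}) = 0"
    using S by (auto simp: supp_def)
  hence "coef f (S - {j}) = 0" "coef f (insert j (S - {j})) = 0"
    using S(2) by (auto simp: coef_restrict0 coef_restrict1)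
  moreover have "S = S - {j} \<or> S = insert j (S - {j})" by auto
  ultimately show False using S(3) by metis
qed

section \<open>The weight of a variable\<close>

definition weight :: "'a set \<Rightarrow> ('a set \<Rightarrow> bool) \<Rightarrow> 'a \<Rightarrow> real" where
  "weight V f i = (if i \<in> \<Union>(supp V f)
     then (1 / 2) ^ Max (card ` {S \<in> supp V f. i \<in> S}) else 0)"

lemma weight_nonneg: "weight V f i \<ge> 0"
  by (simp add: weight_def)

lemma weight_le:
  assumes "finite V" "S \<in> supp V f" "i \<in> S" "k \<le> card S"
  shows "weight V f i \<le> (1 / 2) ^ k"
proof -
  have "k \<le> Max (card ` {S \<in> supp V f. i \<in> S})"
    using assms finite_supp[OF assms(1)] by (intro order.trans[OF assms(4)] Max_ge) auto
  thus ?thesis using assms by (auto simp: weight_def intro!: power_decreasing)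
qed

lemma weight_attained:
  assumes "finite V" "i \<in> \<Union>(supp V f)"
  obtains S where "S \<in> supp V f" "i \<in> S" "weight V f i = (1 / 2) ^ card S"
proof -
  have "Max (card ` {S \<in> supp V f. i \<in> S}) \<in> card ` {S \<in> supp V f. i \<in> S}"
    using assms finite_supp[OF assms(1)] by (intro Max_in) auto
  thus ?thesis using assms that by (auto simp: weight_def)
qed

text \<open>If \<open>i\<close> survives in both restrictions, neither has a monomial through
  \<open>i\<close> of larger degree than \<open>f\<close> has, so both weights are at least that of
  \<open>f\<close>. If \<open>i\<close> survives in only one, a largest monomial \<open>S\<close>
  there through \<open>i\<close> forces \<open>insert j S\<close> to be a monomial of
  \<open>f\<close>; the extra degree halves the weight and makes up for the missing half of the
  average.\<close>

lemma weight_le_average: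
  assumes V: "finite V" "j \<in> V" and "i \<noteq> j"
  shows "weight V f i \<le> (weight V (\<lambda>x. f (x - {j})) i + weight V (\<lambda>x. f (insert j x)) i) / 2"
proof -
  define f0 where "f0 = (\<lambda>x. f (x - {j}))"
  define f1 where "f1 = (\<lambda>x. f (insert j x))"
  have c0: "coef f0 S = (if j \<in> S then 0 else coef f S)"
    and c1: "coef f1 S = (if j \<in> S then 0 else coef f S + coef f (insert j S))" if "S \<subseteq> V" for S
    using that V finite_subset unfolding f0_def f1_def
    by (metis coef_restrict0, metis coef_restrict1)
  have card_ins: "card (insert j S) = Suc (card S)" if "S \<subseteq> V" "j \<notin> S" for S
    using that V finite_subset card_insert_disjoint by metis
  consider "i \<in> \<Union>(supp V f0)" "i \<in> \<Union>(supp V f1)" | "i \<in> \<Union>(supp V f0)" "i \<notin> \<Union>(supp V f1)"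
    | "i \<notin> \<Union>(supp V f0)" "i \<in> \<Union>(supp V f1)" | "i \<notin> \<Union>(supp V f0)" "i \<notin> \<Union>(supp V f1)"
    by blast
  hence "weight V f i \<le> (weight V f0 i + weight V f1 i) / 2"
  proof cases
    case 1
    obtain S0 where S0: "S0 \<in> supp V f0" "i \<in> S0" "weight V f0 i = (1 / 2) ^ card S0"
      using weight_attained[OF V(1) 1(1)] .
    obtain S1 where S1: "S1 \<in> supp V f1" "i \<in> S1" "weight V f1 i = (1 / 2) ^ card S1"
      using weight_attained[OF V(1) 1(2)] .
    have "S0 \<in> supp V f" using supp_restrict0 V S0(1) unfolding f0_def by metis
    hence a: "weight V f i \<le> weight V f0 i" using weight_le[OF V(1)] S0 by fastforce
    have j: "j \<notin> S1" "S1 \<in> supp V f \<or> insert j S1 \<in> supp V f"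
      using supp_restrict1 V S1(1) unfolding f1_def by metis+
    have "card (insert j S1) = Suc (card S1)" using S1 j card_ins by (auto simp: supp_def)
    hence "weight V f i \<le> weight V f1 i"
      using j(2) weight_le[OF V(1), of S1 f i "card S1"]
        weight_le[OF V(1), of "insert j S1" f i "card S1"] S1 by auto
    with a show ?thesis by simp
  next
    case 2
    obtain S where S: "S \<in> supp V f0" "i \<in> S" "weight V f0 i = (1 / 2) ^ card S"
      using weight_attained[OF V(1) 2(1)] .
    have SV: "S \<subseteq> V" "j \<notin> S" using S(1) c0 by (auto simp: supp_def split: if_splits)
    \<comment> \<open>The coefficients of \<open>f\<close> at \<open>S\<close> and
      \<open>insert j S\<close> cancel in \<open>f1\<close>, and the first is nonzero.\<close>
    have "coef f1 S = 0" using 2 S SV by (auto simp: supp_def)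
    hence "insert j S \<in> supp V f" using c0[of S] c1[of S] S SV V by (auto simp: supp_def)
    hence "weight V f i \<le> (1 / 2) ^ Suc (card S)"
      using weight_le[OF V(1), of "insert j S" f i "Suc (card S)"] S card_ins[OF SV] by auto
    thus ?thesis using S(3) weight_nonneg[of V f1 i] by simp
  next
    case 3
    obtain S where S: "S \<in> supp V f1" "i \<in> S" "weight V f1 i = (1 / 2) ^ card S"
      using weight_attained[OF V(1) 3(2)] .
    have SV: "S \<subseteq> V" "j \<notin> S" using S(1) c1 by (auto simp: supp_def split: if_splits)
    have "coef f0 S = 0" using 3 S SV by (auto simp: supp_def)
    hence "insert j S \<in> supp V f" using c0[of S] c1[of S] S SV V by (auto simp: supp_def)
    hence "weight V f i \<le> (1 / 2) ^ Suc (card S)"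
      using weight_le[OF V(1), of "insert j S" f i "Suc (card S)"] S card_ins[OF SV] by auto
    thus ?thesis using S(3) weight_nonneg[of V f0 i] by simp
  next
    case 4
    have "i \<notin> S" if S: "S \<in> supp V f" for S
      using mem_supp_imp_restrict[OF V(1) S, of j] 4 \<open>i \<noteq> j\<close>
      unfolding f0_def f1_def by blast
    hence "weight V f i = 0" by (auto simp: weight_def)
    thus ?thesis using weight_nonneg[of V f0 i] weight_nonneg[of V f1 i] by simp
  qed
  thus ?thesis unfolding f0_def f1_def .
qed

section \<open>Removing the top degree with a hitting set\<close>

definition total_weight :: "'a set \<Rightarrow> ('a set \<Rightarrow> bool) \<Rightarrow> real" where
  "total_weight V f = (\<Sum>i\<in>V. weight V f i)"

text \<open>The variables of \<open>H\<close> are fixed one at a time. Averaging over both values of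
  \<open>j\<close> loses only the weight of \<open>j\<close> itself, which is at most
  \<open>(1 / 2) ^ Suc d\<close> if \<open>j\<close> lies in a monomial of top degree. The
  hypothesis \<open>bnd\<close> stands for the bound already known in degree
  \<open>d\<close>.\<close>

lemma total_weight_hitting_set:
  assumes V: "finite V"
    and bnd: "\<And>g. (\<forall>S\<in>supp V g. card S \<le> d) \<Longrightarrow> total_weight V g \<le> b"
    and "finite H" "H \<subseteq> V" "\<forall>S\<in>supp V f. card S \<le> Suc d"
    and "\<forall>S\<in>supp V f. card S = Suc d \<longrightarrow> S \<inter> H \<noteq> {}"
  shows "total_weight V f \<le> b + real (card H) * (1 / 2) ^ Suc d"
  using assms(3-6)
proof (induction H arbitrary: f rule: finite_induct)
  case empty
  \<comment> \<open>With nothing left to hit them, there are no monomials of degree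
    \<open>Suc d\<close>.\<close>
  hence "total_weight V f \<le> b"
    by (intro bnd) (metis inf_bot_right le_SucE)
  thus ?case by simp
next
  case (insert j H f)
  let ?c = "real (card H) * (1 / 2) ^ Suc d :: real"
  have cH: "real (card (insert j H)) * (1 / 2) ^ Suc d = ?c + (1 / 2) ^ Suc d"
    using insert.hyps by (simp add: algebra_simps)
  show ?case
  proof (cases "\<exists>S\<in>supp V f. card S = Suc d \<and> j \<in> S")
    case False
    \<comment> \<open>Here \<open>j\<close> hits no monomial of top degree, so \<open>H\<close>
      alone suffices and nothing needs to be fixed.\<close>
    hence "total_weight V f \<le> b + ?c" using insert.prems by (intro insert.IH) auto
    moreover have "0 \<le> (1 / 2 :: real) ^ Suc d" by simp
    ultimately show ?thesis unfolding cH by linarith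
  next
    case True
    hence wj: "weight V f j \<le> (1 / 2) ^ Suc d" using weight_le[OF V] by (metis order.refl)
    have j: "j \<in> V" using insert.prems by simp
    let ?f0 = "\<lambda>x. f (x - {j})" and ?f1 = "\<lambda>x. f (insert j x)"
    have 0: "total_weight V ?f0 \<le> b + ?c"
    proof (rule insert.IH)
      show "\<forall>S\<in>supp V ?f0. card S \<le> Suc d"
        using supp_restrict0(2)[OF V] insert.prems(2) by metis
      show "\<forall>S\<in>supp V ?f0. card S = Suc d \<longrightarrow> S \<inter> H \<noteq> {}"
        using supp_restrict0[OF V, of _ f j] insert.prems(3) by fastforce
    qed (use insert.prems in auto)
    have 1: "total_weight V ?f1 \<le> b + ?c"
    proof (rule insert.IH)
      \<comment> \<open>A monomial of the restriction that arises only from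
        \<open>insert j S\<close> has lost a degree, so those still of top degree are monomials of
        \<open>f\<close> avoiding \<open>j\<close> and must be hit by \<open>H\<close>.\<close>
      have *: "j \<notin> S \<and> (S \<in> supp V f \<or> card S \<le> d)" if "S \<in> supp V ?f1" for S
      proof -
        have "j \<notin> S" "S \<in> supp V f \<or> insert j S \<in> supp V f"
          using supp_restrict1[OF V j that] by blast+
        moreover have "finite S" using finite_mem_supp[OF V that] .
        ultimately show ?thesis using insert.prems(2) by fastforce
      qed
      show "\<forall>S\<in>supp V ?f1. card S \<le> Suc d"
        using * insert.prems(2) le_SucI by blast
      show "\<forall>S\<in>supp V ?f1. card S = Suc d \<longrightarrow> S \<inter> H \<noteq> {}"
      proof (intro ballI impI)
        fix S assume "S \<in> supp V ?f1" "card S = Suc d"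
        with * have "j \<notin> S" "S \<in> supp V f" by fastforce+
        thus "S \<inter> H \<noteq> {}" using insert.prems(3) \<open>card S = Suc d\<close> by fastforce
      qed
    qed (use insert.prems in auto)
    have "total_weight V f = weight V f j + (\<Sum>i\<in>V-{j}. weight V f i)"
      using V j by (simp add: total_weight_def sum.remove)
    also have "(\<Sum>i\<in>V-{j}. weight V f i) \<le> (\<Sum>i\<in>V-{j}. (weight V ?f0 i + weight V ?f1 i) / 2)"
      using V j by (intro sum_mono weight_le_average) auto
    also have "\<dots> \<le> (\<Sum>i\<in>V. (weight V ?f0 i + weight V ?f1 i) / 2)"
      using V weight_nonneg[of V ?f0] weight_nonneg[of V ?f1] by (intro sum_mono2) auto
    also have "\<dots> = (total_weight V ?f0 + total_weight V ?f1) / 2"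
      by (simp add: total_weight_def sum.distrib flip: sum_divide_distrib)
    finally have "total_weight V f \<le> (1 / 2) ^ Suc d + (total_weight V ?f0 + total_weight V ?f1) / 2"
      using wj by simp
    thus ?thesis using 0 1 unfolding cH by argo
  qed
qed

section \<open>Polynomials bounded on the unit interval\<close>

lemma lagrange_at_zero:
  fixes p :: "real poly"
  assumes "finite A" "inj_on t A" "degree p < card A"
  shows "poly p 0 = (\<Sum>j\<in>A. poly p (t j) * (\<Prod>l\<in>A-{j}. t l / (t l - t j)))"
proof -
  \<comment> \<open>The factors are \<open>t l - x\<close> rather than \<open>x - t l\<close>, so
    that the values at 0 take the stated form without signs.\<close>
  define L where "L j = (\<Prod>l\<in>A-{j}. smult (1 / (t l - t j)) [:t l, -1:])" for j
  define q where "q = (\<Sum>j\<in>A. smult (poly p (t j)) (L j))"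
  have L: "poly (L j) x = (\<Prod>l\<in>A-{j}. (t l - x) / (t l - t j))" for j x
    by (simp add: L_def poly_prod diff_divide_distrib)
  have "degree (L j) \<le> card A - 1" if "j \<in> A" for j
  proof -
    have "degree (L j) \<le> (\<Sum>l\<in>A-{j}. degree (smult (1 / (t l - t j)) [:t l, -1:]))"
      unfolding L_def using assms(1) by (intro degree_prod_sum_le[unfolded o_def]) simp
    also have "\<dots> \<le> (\<Sum>l\<in>A-{j}. 1)" by (intro sum_mono) simp
    finally show ?thesis using that assms(1) by simp
  qed
  hence "degree q \<le> card A - 1"
    unfolding q_def using assms(1)
    by (intro degree_sum_le) (auto intro: order.trans[OF degree_smult_le])
  hence deg: "degree q < card A" using assms(3) by linarith
  have "poly p (t i) = poly q (t i)" if i: "i \<in> A" for i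
  proof -
    have "poly (L j) (t i) = (if j = i then 1 else 0)" if j: "j \<in> A" for j
    proof (cases "j = i")
      case True
      have "t l - t i \<noteq> 0" if "l \<in> A - {i}" for l
        using assms(2) i that by (auto simp: inj_on_def)
      thus ?thesis using True by (simp add: L)
    next
      case False
      hence "i \<in> A - {j}" using i by auto
      thus ?thesis using False assms(1) by (auto simp: L intro!: prod_zero)
    qed
    hence "poly q (t i) = (\<Sum>j\<in>A. if j = i then poly p (t j) else 0)"
      unfolding q_def by (auto simp: poly_sum intro!: sum.cong)
    thus ?thesis using assms(1) i by simp
  qed
  moreover have "card (t ` A) = card A" using assms(2) by (rule card_image)
  ultimately have "p = q"
    using assms(3) deg by (intro poly_eqI_degree[of "t ` A"]) auto
  hence "poly p 0 = poly q 0" by simp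
  also have "\<dots> = (\<Sum>j\<in>A. poly p (t j) * (\<Prod>l\<in>A-{j}. t l / (t l - t j)))"
    by (simp add: q_def poly_sum L)
  finally show ?thesis .
qed

text \<open>Factoring each denominator as \<open>(j - l) * (j + l)\<close> turns the product into
  factorials. This is the case \<open>d = j\<close> of the next identity.\<close>

lemma prod_square_nodes_below:
  "(\<Prod>l\<in>{1..<j}. (real l)\<^sup>2 / ((real j)\<^sup>2 - (real l)\<^sup>2)) * fact (2 * j) = 2 * (fact j)\<^sup>2"
  if "j \<ge> 1"
proof -
  obtain m where m: "j = Suc m" using \<open>j \<ge> 1\<close> by (cases j) auto
  have I: "{1..<j} = {1..m}" using m by auto
  have a: "(\<Prod>l\<in>{1..<j}. (real l)\<^sup>2) = (fact m)\<^sup>2"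
    unfolding I by (simp add: fact_prod prod_power_distrib)
  have b: "(\<Prod>l\<in>{1..<j}. real j - real l) = fact m"
  proof -
    have "(\<Prod>l\<in>{1..<j}. real j - real l) = (\<Prod>l\<in>{1..m}. real l)"
      by (rule prod.reindex_bij_witness[of _ "\<lambda>l. j - l" "\<lambda>l. j - l"]) (auto simp: m)
    thus ?thesis by (simp add: fact_prod)
  qed
  have c: "(\<Prod>l\<in>{1..k}. real j + real l) * fact j = fact (j + k)" for k
  proof (induction k)
    case (Suc k)
    have "(\<Prod>l\<in>{1..Suc k}. real j + real l) * fact j
        = (real j + real (Suc k)) * ((\<Prod>l\<in>{1..k}. real j + real l) * fact j)"
      by (simp add: mult_ac)
    also have "\<dots> = fact (j + Suc k)" unfolding Suc by simp
    finally show ?case .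
  qed simp
  have "(\<Prod>l\<in>{1..<j}. (real j)\<^sup>2 - (real l)\<^sup>2)
      = (\<Prod>l\<in>{1..<j}. real j - real l) * (\<Prod>l\<in>{1..m}. real j + real l)"
    unfolding I by (simp add: power2_eq_square algebra_simps flip: prod.distrib)
  hence d: "(\<Prod>l\<in>{1..<j}. (real j)\<^sup>2 - (real l)\<^sup>2) * fact j = fact m * fact (j + m)"
    unfolding b using c[of m] by simp
  have F: "fact (2 * j) = real (2 * j) * fact (j + m)" "fact j = real j * fact m"
    by (simp_all add: m mult_2 del: of_nat_Suc)
  have "(\<Prod>l\<in>{1..<j}. (real l)\<^sup>2 / ((real j)\<^sup>2 - (real l)\<^sup>2))
     = (fact m)\<^sup>2 / (fact m * fact (j + m) / fact j)"
    unfolding prod_dividef a d[symmetric] by simp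
  thus ?thesis using \<open>j \<ge> 1\<close> by (simp add: F(1) power2_eq_square) (simp add: F(2))
qed

text \<open>Induction on \<open>d\<close> starting at \<open>j\<close>: the new node
  \<open>d + 1\<close> contributes the factor
  \<open>(d + 1)\<^sup>2 / ((d + 1 - j) * (d + 1 + j))\<close>, which matches the growth of the
  factorials.\<close>

lemma prod_square_nodes:
  assumes "1 \<le> j" "j \<le> d"
  shows "(\<Prod>l\<in>{1..d}-{j}. (real l)\<^sup>2 / \<bar>(real l)\<^sup>2 - (real j)\<^sup>2\<bar>) * (fact (d - j) * fact (d + j))
    = 2 * (fact d)\<^sup>2"
  using assms(2)
proof (induction d rule: dec_induct)
  case base
  have "(\<Prod>l\<in>{1..j}-{j}. (real l)\<^sup>2 / \<bar>(real l)\<^sup>2 - (real j)\<^sup>2\<bar>)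
     = (\<Prod>l\<in>{1..<j}. (real l)\<^sup>2 / ((real j)\<^sup>2 - (real l)\<^sup>2))"
  proof (rule prod.cong)
    fix l assume "l \<in> {1..<j}"
    hence "(real l)\<^sup>2 \<le> (real j)\<^sup>2" by (intro power_mono) auto
    hence "\<bar>(real l)\<^sup>2 - (real j)\<^sup>2\<bar> = (real j)\<^sup>2 - (real l)\<^sup>2" by linarith
    thus "(real l)\<^sup>2 / \<bar>(real l)\<^sup>2 - (real j)\<^sup>2\<bar> = (real l)\<^sup>2 / ((real j)\<^sup>2 - (real l)\<^sup>2)"
      by (rule arg_cong)
  qed auto
  moreover have "fact (j - j) * fact (j + j) = (fact (2 * j) :: real)"
    by (simp flip: mult_2)
  ultimately show ?case using prod_square_nodes_below[OF assms(1)] by metis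
next
  case (step d)
  let ?P = "\<Prod>l\<in>{1..d}-{j}. (real l)\<^sup>2 / \<bar>(real l)\<^sup>2 - (real j)\<^sup>2\<bar>"
  have "{1..Suc d} - {j} = insert (Suc d) ({1..d} - {j})" using step by auto
  hence P: "(\<Prod>l\<in>{1..Suc d}-{j}. (real l)\<^sup>2 / \<bar>(real l)\<^sup>2 - (real j)\<^sup>2\<bar>)
      = (real (Suc d))\<^sup>2 / \<bar>(real (Suc d))\<^sup>2 - (real j)\<^sup>2\<bar> * ?P"
    by simp
  have pos: "real (Suc d) - real j > 0" "real (Suc d) + real j > 0" using step by auto
  have "\<bar>(real (Suc d))\<^sup>2 - (real j)\<^sup>2\<bar> = (real (Suc d) - real j) * (real (Suc d) + real j)"
  proof -
    have "(real (Suc d))\<^sup>2 - (real j)\<^sup>2 = (real (Suc d) - real j) * (real (Suc d) + real j)"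
      by (simp add: power2_eq_square algebra_simps)
    thus ?thesis using mult_pos_pos[OF pos] by linarith
  qed
  moreover have "fact (Suc d - j) = (real (Suc d) - real j) * fact (d - j)"
    using step by (simp add: Suc_diff_le of_nat_diff algebra_simps)
  moreover have "fact (Suc d + j) = (real (Suc d) + real j) * fact (d + j)"
    by (simp add: algebra_simps)
  \<comment> \<open>The cancellation in abstract form: the factors \<open>a\<close> and
    \<open>b\<close> of the new denominator are exactly what the two factorials gain.\<close>
  moreover have "s / (a * b) * P * ((a * x) * (b * y)) = s * (P * (x * y))"
    if "a > 0" "b > 0" for s a b P x y :: real
    using that by simp
  ultimately have "(\<Prod>l\<in>{1..Suc d}-{j}. (real l)\<^sup>2 / \<bar>(real l)\<^sup>2 - (real j)\<^sup>2\<bar>)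
      * (fact (Suc d - j) * fact (Suc d + j)) = (real (Suc d))\<^sup>2 * (?P * (fact (d - j) * fact (d + j)))"
    unfolding P using pos by presburger
  also have "\<dots> = 2 * (fact (Suc d))\<^sup>2"
    unfolding step.IH by (simp add: power2_eq_square algebra_simps)
  finally show ?case .
qed

text \<open>By the identity above, the product is twice the ratio of
  \<open>2 * d choose (d - j)\<close> to the central binomial coefficient, which is the largest
  one.\<close>

lemma prod_square_nodes_le:
  assumes "1 \<le> j" "j \<le> d"
  shows "(\<Prod>l\<in>{1..d}-{j}. (real l)\<^sup>2 / \<bar>(real l)\<^sup>2 - (real j)\<^sup>2\<bar>) \<le> 2"
proof -
  have "2 * d choose (d - j) \<le> 2 * d choose d"
    using binomial_maximum[of "2 * d" "d - j"] by simp
  hence "real (2 * d choose (d - j)) \<le> real (2 * d choose d)" by simp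
  moreover have "2 * d - (d - j) = d + j" "2 * d - d = d" using assms by simp_all
  ultimately have "fact (2 * d) / (fact (d - j) * fact (d + j)) \<le> (fact (2 * d) / (fact d * fact d) :: real)"
    using binomial_fact[of "d - j" "2 * d", where 'a = real]
      binomial_fact[of d "2 * d", where 'a = real]
    by (metis diff_le_self le_add1 mult_2 order.trans)
  hence "(fact d)\<^sup>2 \<le> (fact (d - j) * fact (d + j) :: real)"
    by (simp add: field_simps power2_eq_square)
  hence "(\<Prod>l\<in>{1..d}-{j}. (real l)\<^sup>2 / \<bar>(real l)\<^sup>2 - (real j)\<^sup>2\<bar>) * (fact (d - j) * fact (d + j))
      \<le> 2 * (fact (d - j) * fact (d + j))"
    unfolding prod_square_nodes[OF assms] by simp
  thus ?thesis by (rule mult_right_le_imp_le) simp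
qed

text \<open>Comparison with a telescoping sum; the term \<open>1 / real d\<close> is what makes the
  induction close.\<close>

lemma sum_inverse_squares_le:
  assumes "d \<ge> 1"
  shows "(\<Sum>j=1..d. 1 / (real j)\<^sup>2) \<le> 2 - 1 / real d"
  using assms
proof (induction d rule: nat_induct_at_least)
  case (Suc d)
  have "1 / (real (Suc d))\<^sup>2 \<le> 1 / real d - 1 / real (Suc d)"
  proof -
    have "1 / (real (Suc d) * real (Suc d)) \<le> 1 / (real d * real (Suc d))"
      using Suc.hyps by (intro divide_left_mono mult_right_mono) auto
    also have "\<dots> = 1 / real d - 1 / real (Suc d)"
      using Suc.hyps by (simp add: field_simps)
    finally show ?thesis by (simp only: power2_eq_square)
  qed
  thus ?case using Suc by simp
qed simp

text \<open>Lagrange interpolation of \<open>(p x - p 0) / x\<close> at the nodes \<open>j\<^sup>2 / d\<^sup>2\<close>, which cluster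
  at \<open>0\<close> like Chebyshev nodes.\<close>

lemma coeff_1_le_of_bounded:
  fixes p :: "real poly"
  assumes deg: "degree p \<le> d" and bnd: "\<And>x. 0 \<le> x \<Longrightarrow> x \<le> 1 \<Longrightarrow> \<bar>poly p x - poly p 0\<bar> \<le> 1"
  shows "\<bar>coeff p 1\<bar> \<le> 4 * real d ^ 2"
proof (cases "d = 0")
  case True
  thus ?thesis using deg by (simp add: coeff_eq_0)
next
  case False
  hence d: "d \<ge> 1" by simp
  \<comment> \<open>Here \<open>r\<close> is the quotient \<open>(p x - p 0) / x\<close>, so
    \<open>coeff p 1\<close> is the value of \<open>r\<close> at 0, and its degree is below the
    number \<open>d\<close> of nodes.\<close>
  obtain a r where p: "p = pCons a r" by (cases p)
  have "degree r < d" using deg d unfolding p by (auto simp: degree_pCons_eq_if split: if_splits)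
  define t where "t j = (real j)\<^sup>2 / (real d)\<^sup>2" for j
  have inj: "inj_on t {1..d}" using False by (auto simp: inj_on_def t_def)
  have ratio: "\<bar>t l / (t l - t j)\<bar> = (real l)\<^sup>2 / \<bar>(real l)\<^sup>2 - (real j)\<^sup>2\<bar>" for l j
    using False by (simp add: t_def flip: diff_divide_distrib)
  have r: "\<bar>poly r (t j)\<bar> \<le> (real d)\<^sup>2 * (1 / (real j)\<^sup>2)" if "j \<in> {1..d}" for j
  proof -
    have "0 < t j" "t j \<le> 1" using that by (auto simp: t_def intro!: power_mono)
    hence "t j * \<bar>poly r (t j)\<bar> \<le> 1" using bnd[of "t j"] by (simp add: p abs_mult)
    hence "\<bar>poly r (t j)\<bar> \<le> 1 / t j" using \<open>0 < t j\<close> by (simp add: field_simps)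
    thus ?thesis by (simp add: t_def)
  qed
  have "\<bar>poly r 0\<bar> \<le> (\<Sum>j=1..d. \<bar>poly r (t j)\<bar> * (\<Prod>l\<in>{1..d}-{j}. \<bar>t l / (t l - t j)\<bar>))"
    using lagrange_at_zero[OF _ inj, of r] \<open>degree r < d\<close>
    by (auto simp: abs_mult abs_prod intro!: order.trans[OF sum_abs])
  \<comment> \<open>Each Lagrange factor is at most 2, and the inverse squares sum to at most 2;
    together they give the constant 4.\<close>
  also have "\<dots> \<le> (\<Sum>j=1..d. ((real d)\<^sup>2 * (1 / (real j)\<^sup>2)) * 2)"
    using r prod_square_nodes_le unfolding ratio
    by (intro sum_mono mult_mono) (auto intro!: prod_nonneg)
  also have "\<dots> = 2 * (real d)\<^sup>2 * (\<Sum>j=1..d. 1 / (real j)\<^sup>2)"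
    by (simp add: sum_distrib_left mult_ac)
  also have "\<dots> \<le> 2 * (real d)\<^sup>2 * 2"
  proof (rule mult_left_mono)
    have "0 \<le> 1 / real d" by simp
    thus "(\<Sum>j=1..d. 1 / (real j)\<^sup>2) \<le> 2" using sum_inverse_squares_le[OF d] by linarith
  qed simp
  finally show ?thesis by (simp add: p poly_0_coeff_0)
qed

section \<open>Few disjoint monomials of maximal degree\<close>

text \<open>The probability that a random subset of \<open>I\<close>, containing each point
  independently with probability \<open>q\<close>, includes \<open>T\<close>. The sum is the
  expansion of a product over \<open>I\<close> of two-term factors.\<close>

lemma sum_superset_weights:
  fixes q :: real
  assumes "finite I" "T \<subseteq> I"
  shows "(\<Sum>Y\<in>Pow I. of_bool (T \<subseteq> Y) * (q ^ card Y * (1 - q) ^ card (I - Y))) = q ^ card T"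
proof -
  have "q ^ card T = (\<Prod>i\<in>I. if i \<in> T then q else 1)"
    using assms by (simp add: prod.If_cases Int_absorb1)
  also have "\<dots> = (\<Prod>i\<in>I. q + (if i \<in> T then 0 else 1 - q))"
    by (intro prod.cong) auto
  also have "\<dots> = (\<Sum>Y\<in>Pow I. (\<Prod>i\<in>Y. q) * (\<Prod>i\<in>I-Y. if i \<in> T then 0 else 1 - q))"
    using assms(1) by (rule prod_add)
  also have "\<dots> = (\<Sum>Y\<in>Pow I. of_bool (T \<subseteq> Y) * (q ^ card Y * (1 - q) ^ card (I - Y)))"
  proof (rule sum.cong)
    fix Y assume Y: "Y \<in> Pow I"
    have "(\<Prod>i\<in>I-Y. if i \<in> T then 0 else 1 - q) = of_bool (T \<subseteq> Y) * (1 - q) ^ card (I - Y)"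
    proof (cases "T \<subseteq> Y")
      case True
      hence "(\<Prod>i\<in>I-Y. if i \<in> T then 0 else 1 - q) = (\<Prod>i\<in>I-Y. 1 - q)"
        by (intro prod.cong) auto
      thus ?thesis using True by simp
    next
      case False
      thus ?thesis using assms by (auto intro!: prod_zero)
    qed
    thus "(\<Prod>i\<in>Y. q) * (\<Prod>i\<in>I-Y. if i \<in> T then 0 else 1 - q)
        = of_bool (T \<subseteq> Y) * (q ^ card Y * (1 - q) ^ card (I - Y))"
      by simp
  qed simp
  finally show ?thesis by simp
qed

text \<open>Switching on each block independently with probability \<open>q\<close>, the expectation of \<open>f\<close> is a
  polynomial of degree at most \<open>d\<close> in \<open>q\<close> with values in \<open>[0, 1]\<close>, whose derivative at \<open>0\<close> is, up
  to sign, the number of blocks.\<close>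

lemma card_disjoint_sensitive_blocks:
  fixes B :: "'i \<Rightarrow> 'a set"
  assumes V: "finite V" and I: "finite I" and BV: "\<And>i. i \<in> I \<Longrightarrow> B i \<subseteq> V"
    and disj: "\<And>i j. i \<in> I \<Longrightarrow> j \<in> I \<Longrightarrow> i \<noteq> j \<Longrightarrow> B i \<inter> B j = {}"
    and deg: "\<forall>S\<in>supp V f. card S \<le> d" and sens: "\<And>i. i \<in> I \<Longrightarrow> f (B i) \<noteq> f {}"
  shows "real (card I) \<le> 4 * real d ^ 2"
proof -
  define U where "U = (\<Union>i\<in>I. B i)"
  define hits where "hits S = {i \<in> I. B i \<inter> S \<noteq> {}}" for S
  \<comment> \<open>A monomial \<open>S\<close> equals 1 exactly when every block it meets is
    switched on, which has probability \<open>q ^ card (hits S)\<close>.\<close>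
  define p where "p = (\<Sum>S\<in>Pow U. monom (coef f S) (card (hits S)))"
  have "U \<subseteq> V" using BV by (auto simp: U_def)
  hence U: "U \<subseteq> V" "finite U" using V finite_subset by blast+
  have fB: "finite (B i)" if "i \<in> I" for i using BV[OF that] V finite_subset by blast
  \<comment> \<open>Picking a point of \<open>S\<close> in each block met is injective because the
    blocks are disjoint. This bounds the degree of \<open>p\<close>.\<close>
  have hits_le: "card (hits S) \<le> card S" if "S \<subseteq> U" for S
  proof (rule card_inj_on_le[where f = "\<lambda>i. SOME x. x \<in> B i \<inter> S"])
    have x: "(SOME x. x \<in> B i \<inter> S) \<in> B i \<inter> S" if "i \<in> hits S" for i
    proof -
      have "\<exists>x. x \<in> B i \<inter> S" using that by (auto simp: hits_def)
      thus ?thesis by (rule someI_ex)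
    qed
    show "inj_on (\<lambda>i. SOME x. x \<in> B i \<inter> S) (hits S)"
    proof (rule inj_onI)
      fix i j assume ij: "i \<in> hits S" "j \<in> hits S"
        "(SOME x. x \<in> B i \<inter> S) = (SOME x. x \<in> B j \<inter> S)"
      hence "B i \<inter> B j \<noteq> {}" using x[of i] x[of j] by auto
      thus "i = j" using disj[of i j] ij by (auto simp: hits_def)
    qed
    show "(\<lambda>i. SOME x. x \<in> B i \<inter> S) ` hits S \<subseteq> S" using x by blast
    show "finite S" using that U finite_subset by blast
  qed
  have "degree p \<le> d"
    unfolding p_def
  proof (rule degree_sum_le)
    fix S assume S: "S \<in> Pow U"
    show "degree (monom (coef f S) (card (hits S))) \<le> d"
    proof (cases "coef f S = 0")
      case False
      hence "S \<in> supp V f" using S U by (auto simp: supp_def)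
      thus ?thesis using deg hits_le[of S] S False by (fastforce simp: degree_monom_eq)
    qed simp
  qed (use U in simp)
  moreover
  define w where "w q Y = q ^ card Y * (1 - q) ^ card (I - Y)" for q :: real and Y
  \<comment> \<open>The same expectation as a weighted average of values of \<open>f\<close>, from
    which the range \<open>[0, 1]\<close> is read off.\<close>
  have poly_p: "poly p q = (\<Sum>Y\<in>Pow I. w q Y * of_bool (f (\<Union>i\<in>Y. B i)))" for q
  proof -
    have *: "of_bool (f (\<Union>i\<in>Y. B i)) = (\<Sum>S\<in>Pow U. coef f S * of_bool (hits S \<subseteq> Y))"
      if Y: "Y \<in> Pow I" for Y
    proof -
      have sub: "(\<Union>i\<in>Y. B i) \<subseteq> U" using Y by (auto simp: U_def)
      have iff: "S \<subseteq> (\<Union>i\<in>Y. B i) \<longleftrightarrow> hits S \<subseteq> Y" if "S \<subseteq> U" for S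
      proof
        assume S: "S \<subseteq> (\<Union>i\<in>Y. B i)"
        show "hits S \<subseteq> Y"
        proof
          fix i assume "i \<in> hits S"
          then obtain x where x: "x \<in> B i" "x \<in> S" "i \<in> I" by (auto simp: hits_def)
          then obtain k where "k \<in> Y" "x \<in> B k" using S by auto
          thus "i \<in> Y" using disj[of i k] x Y by blast
        qed
      next
        assume "hits S \<subseteq> Y"
        thus "S \<subseteq> (\<Union>i\<in>Y. B i)" using that by (fastforce simp: U_def hits_def)
      qed
      have "(\<Sum>S\<in>Pow U. coef f S * of_bool (hits S \<subseteq> Y))
          = (\<Sum>S\<in>Pow U. if S \<in> Pow (\<Union>i\<in>Y. B i) then coef f S else 0)"
        by (intro sum.cong refl) (simp add: iff)
      also have "\<dots> = (\<Sum>S\<in>Pow (\<Union>i\<in>Y. B i). coef f S)"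
        using U sub by (intro sum.mono_neutral_cong_right) auto
      also have "\<dots> = of_bool (f (\<Union>i\<in>Y. B i))"
        using sub U finite_subset by (intro sum_coef) blast
      finally show ?thesis by simp
    qed
    have "(\<Sum>Y\<in>Pow I. w q Y * of_bool (f (\<Union>i\<in>Y. B i)))
       = (\<Sum>Y\<in>Pow I. \<Sum>S\<in>Pow U. coef f S * (of_bool (hits S \<subseteq> Y) * w q Y))"
      by (intro sum.cong refl) (simp add: * sum_distrib_left mult_ac)
    also have "\<dots> = (\<Sum>S\<in>Pow U. coef f S * (\<Sum>Y\<in>Pow I. of_bool (hits S \<subseteq> Y) * w q Y))"
      by (subst sum.swap) (simp add: sum_distrib_left)
    also have "\<dots> = (\<Sum>S\<in>Pow U. coef f S * q ^ card (hits S))"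
      unfolding w_def by (subst sum_superset_weights[OF I]) (auto simp: hits_def)
    finally show ?thesis by (simp add: p_def poly_sum poly_monom)
  qed
  have p01: "0 \<le> poly p q \<and> poly p q \<le> 1" if "0 \<le> q" "q \<le> 1" for q
  proof
    have w: "0 \<le> w q Y" for Y using that by (simp add: w_def)
    show "0 \<le> poly p q" unfolding poly_p using w by (intro sum_nonneg) auto
    have "poly p q \<le> (\<Sum>Y\<in>Pow I. of_bool ({} \<subseteq> Y) * w q Y)"
      unfolding poly_p using w by (intro sum_mono) auto
    also have "\<dots> = 1" unfolding w_def by (subst sum_superset_weights[OF I]) auto
    finally show "poly p q \<le> 1" .
  qed
  have "\<bar>poly p x - poly p 0\<bar> \<le> 1" if "0 \<le> x" "x \<le> 1" for x
    using p01[OF that] p01[of 0] by auto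
  ultimately have "\<bar>coeff p 1\<bar> \<le> 4 * real d ^ 2" by (rule coeff_1_le_of_bounded)
  moreover have "\<bar>coeff p 1\<bar> = real (card I)"
  proof -
    \<comment> \<open>The linear coefficient collects the monomials meeting exactly one block. For
      each block their coefficients sum to \<open>f (B i) - f {}\<close>, the empty monomial being
      left out.\<close>
    have *: "{S \<in> Pow U. card (hits S) = 1} = (\<Union>i\<in>I. Pow (B i) - {{}})"
    proof (intro equalityI subsetI)
      fix S assume "S \<in> {S \<in> Pow U. card (hits S) = 1}"
      then obtain i where S: "S \<subseteq> U" "hits S = {i}" by (auto simp: card_1_singleton_iff)
      hence "S \<subseteq> B i" by (fastforce simp: U_def hits_def)
      thus "S \<in> (\<Union>i\<in>I. Pow (B i) - {{}})" using S(2) by (auto simp: hits_def)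
    next
      fix S assume "S \<in> (\<Union>i\<in>I. Pow (B i) - {{}})"
      then obtain i where i: "i \<in> I" "S \<subseteq> B i" "S \<noteq> {}" by auto
      hence "hits S = {i}" using disj[of _ i] by (fastforce simp: hits_def)
      thus "S \<in> {S \<in> Pow U. card (hits S) = 1}" using i by (auto simp: U_def)
    qed
    have "coeff p 1 = (\<Sum>S\<in>Pow U. if card (hits S) = 1 then coef f S else 0)"
      by (simp add: p_def coeff_sum)
    also have "\<dots> = (\<Sum>S\<in>(\<Union>i\<in>I. Pow (B i) - {{}}). coef f S)"
      unfolding *[symmetric] using U by (intro sum.inter_filter[symmetric]) simp
    also have "\<dots> = (\<Sum>i\<in>I. \<Sum>S\<in>Pow (B i) - {{}}. coef f S)"
      using I fB disj by (intro sum.UNION_disjoint) blast+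
    also have "\<dots> = (\<Sum>i\<in>I. of_bool (f (B i)) - of_bool (f {}))"
      using fB by (intro sum.cong) (auto simp: sum_diff1 sum_coef coef_empty)
    \<comment> \<open>All differences have the same sign, since each block flips the same value
      \<open>f {}\<close>; hence nothing cancels.\<close>
    also have "\<dots> = (\<Sum>i\<in>I. if f {} then -1 else 1)"
      using sens by (intro sum.cong) auto
    finally show ?thesis by simp
  qed
  ultimately show ?thesis by simp
qed

text \<open>If \<open>f\<close> were constant on the subsets of \<open>M\<close>, the constant
  expansion would represent it there, and uniqueness would give coefficient 0 at the nonempty set
  \<open>M\<close>.\<close>

lemma coef_nonzero_imp_sensitive:
  assumes "finite M" "M \<noteq> {}" "coef f M \<noteq> 0"
  shows "\<exists>B\<subseteq>M. f B \<noteq> f {}"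
proof (rule ccontr)
  assume const: "\<not> ?thesis"
  have "(if M = {} then of_bool (f {}) else 0) = coef f M"
  proof (rule coef_unique[OF assms(1) _ order.refl])
    fix x assume x: "x \<subseteq> M"
    hence "f x = f {}" "finite x" using const assms(1) finite_subset by blast+
    thus "(\<Sum>S\<in>Pow x. if S = {} then of_bool (f {}) else 0) = of_bool (f x)" by simp
  qed
  thus False using assms by simp
qed

lemma hitting_set_exists:
  assumes V: "finite V" and deg: "\<forall>S\<in>supp V f. card S \<le> d" and d: "d > 0"
  obtains H where "H \<subseteq> V" "\<forall>S\<in>supp V f. card S = d \<longrightarrow> S \<inter> H \<noteq> {}"
    "real (card H) \<le> 4 * real d ^ 3"
proof -
  let ?M = "{S \<in> supp V f. card S = d}"
  let ?F = "{A. A \<subseteq> ?M \<and> pairwise disjnt A}"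
  have "finite ?M" using finite_supp[OF V] by simp
  hence "finite ?F" by simp
  moreover have "{} \<in> ?F" by simp
  ultimately have "\<exists>A\<in>?F. {} \<subseteq> A \<and> (\<forall>A'\<in>?F. A \<subseteq> A' \<longrightarrow> A = A')"
    by (rule finite_has_maximal2)
  then obtain A where A: "A \<in> ?F" "\<forall>A'\<in>?F. A \<subseteq> A' \<longrightarrow> A = A'"
    by (elim bexE conjE)
  have finA: "finite A" using A(1) \<open>finite ?M\<close> finite_subset by blast
  have mem: "S \<subseteq> V" "finite S" "coef f S \<noteq> 0" "card S = d" "S \<noteq> {}" if "S \<in> ?M" for S
    using that d V finite_subset by (auto simp: supp_def)
  define H where "H = \<Union>A"
  have hit: "S \<inter> H \<noteq> {}" if S: "S \<in> ?M" for S
  proof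
    assume "S \<inter> H = {}"
    \<comment> \<open>A monomial missed by \<open>H\<close> could join the family. Maximality then
      puts it into \<open>A\<close>, hence inside \<open>H\<close>, which is absurd since
      \<open>d > 0\<close> makes it nonempty.\<close>
    hence "insert S A \<in> ?F" using A(1) S by (auto simp: H_def pairwise_insert disjnt_def)
    hence "A = insert S A" using bspec[OF A(2)] by blast
    hence "S \<in> A" by blast
    thus False using \<open>S \<inter> H = {}\<close> mem(5)[OF S] by (auto simp: H_def)
  qed
  have AM: "M \<in> ?M" if "M \<in> A" for M using A(1) that by auto
  \<comment> \<open>Sensitive blocks chosen inside disjoint monomials are again disjoint.\<close>
  have "\<exists>B\<subseteq>M. f B \<noteq> f {}" if "M \<in> A" for M
    using mem(2,5,3)[OF AM[OF that]] by (rule coef_nonzero_imp_sensitive)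
  then obtain B where B: "\<And>M. M \<in> A \<Longrightarrow> B M \<subseteq> M" "\<And>M. M \<in> A \<Longrightarrow> f (B M) \<noteq> f {}"
    by metis
  have "real (card A) \<le> 4 * real d ^ 2"
  proof (rule card_disjoint_sensitive_blocks[OF V finA _ _ deg])
    show "B M \<subseteq> V" if "M \<in> A" for M using B(1)[OF that] mem(1)[OF AM[OF that]] by simp
    show "B M \<inter> B N = {}" if "M \<in> A" "N \<in> A" "M \<noteq> N" for M N
    proof -
      have "disjnt M N" using A(1) that by (auto dest: pairwiseD)
      thus ?thesis using B(1)[OF that(1)] B(1)[OF that(2)] unfolding disjnt_def by blast
    qed
  qed (rule B(2))
  moreover have "card H \<le> card A * d"
  proof -
    have "card H \<le> (\<Sum>S\<in>A. card S)"
      unfolding H_def using mem(2)[OF AM] by (intro card_Union_le_sum_card)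
    also have "\<dots> = (\<Sum>S\<in>A. d)" using mem(4)[OF AM] by (intro sum.cong) auto
    finally show ?thesis by simp
  qed
  ultimately have "real (card H) \<le> (4 * real d ^ 2) * real d"
    by (smt (verit) mult_right_mono of_nat_0_le_iff of_nat_le_iff of_nat_mult)
  hence "real (card H) \<le> 4 * real d ^ 3" by (simp add: power2_eq_square power3_eq_cube mult_ac)
  moreover have "H \<subseteq> V" using mem(1)[OF AM] unfolding H_def by (intro Union_least)
  ultimately show ?thesis using that hit by blast
qed

text \<open>The bound is \<open>4\<close> times the partial sum up to \<open>d\<close> of the series with terms \<open>e\<^sup>3 / 2\<^sup>e\<close>,
  whose total is \<open>26\<close>.\<close>

lemma total_weight_le:
  assumes "finite V" "\<forall>S\<in>supp V f. card S \<le> d"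
  shows "total_weight V f
    \<le> 4 * (26 - (real d ^ 3 + 6 * real d ^ 2 + 18 * real d + 26) / 2 ^ d)"
  using assms(2)
proof (induction d arbitrary: f)
  case 0
  \<comment> \<open>In degree 0 only the empty monomial can occur; the claimed bound is 0 as
    well.\<close>
  have "weight V f i = 0" for i
    using 0 finite_mem_supp[OF assms(1)] by (fastforce simp: weight_def)
  thus ?case by (simp add: total_weight_def)
next
  case (Suc d)
  let ?b = "4 * (26 - (real d ^ 3 + 6 * real d ^ 2 + 18 * real d + 26) / 2 ^ d)"
  obtain H where H: "H \<subseteq> V" "\<forall>S\<in>supp V f. card S = Suc d \<longrightarrow> S \<inter> H \<noteq> {}"
    "real (card H) \<le> 4 * real (Suc d) ^ 3"
    using hitting_set_exists[OF assms(1) Suc.prems] by auto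
  have "total_weight V f \<le> ?b + real (card H) * (1 / 2) ^ Suc d"
    using H finite_subset[OF H(1) assms(1)] Suc
    by (intro total_weight_hitting_set[OF assms(1)]) auto
  also have "\<dots> \<le> ?b + (4 * real (Suc d) ^ 3) * (1 / 2) ^ Suc d"
    using H(3) by (intro add_left_mono mult_right_mono) auto
  \<comment> \<open>The cubic \<open>P d\<close> in the numerator solves
    \<open>2 * P d - P (d + 1) = (d + 1) ^ 3\<close>, so the new term is absorbed exactly.\<close>
  also have "\<dots> = 4 * (26 - (real (Suc d) ^ 3 + 6 * real (Suc d) ^ 2 + 18 * real (Suc d) + 26) / 2 ^ Suc d)"
    by (simp add: field_simps power2_eq_square power3_eq_cube)
  finally show ?case .
qed

section \<open>Degree and relevant variables\<close>

text \<open>Resolves the definite description: \<open>sum_coef\<close> gives existence and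
  \<open>coef_unique\<close> uniqueness.\<close>

lemma mlcoef_eq: "mlcoef n f = (\<lambda>S. if S \<subseteq> {..<n} then coef f S else 0)"
  unfolding mlcoef_def
proof (rule the_equality)
  show "(\<forall>S. \<not> S \<subseteq> {..<n} \<longrightarrow> (if S \<subseteq> {..<n} then coef f S else 0) = 0) \<and>
    (\<forall>x. x \<subseteq> {..<n} \<longrightarrow>
      of_bool (f x) = (\<Sum>S\<in>Pow x. if S \<subseteq> {..<n} then coef f S else 0))"
  proof (intro conjI allI impI)
    fix x assume x: "x \<subseteq> {..<n}"
    have "(\<Sum>S\<in>Pow x. if S \<subseteq> {..<n} then coef f S else 0) = (\<Sum>S\<in>Pow x. coef f S)"
      using x by (intro sum.cong) auto
    also have "\<dots> = of_bool (f x)"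
      using x finite_subset by (intro sum_coef) blast
    finally show "of_bool (f x) = (\<Sum>S\<in>Pow x. if S \<subseteq> {..<n} then coef f S else 0)" by simp
  qed simp
next
  fix c :: "nat set \<Rightarrow> real" assume c: "(\<forall>S. \<not> S \<subseteq> {..<n} \<longrightarrow> c S = 0) \<and>
    (\<forall>x. x \<subseteq> {..<n} \<longrightarrow> of_bool (f x) = (\<Sum>S\<in>Pow x. c S))"
  have "c S = coef f S" if "S \<subseteq> {..<n}" for S
    by (rule coef_unique[OF finite_lessThan _ that]) (use c in simp)
  thus "c = (\<lambda>S. if S \<subseteq> {..<n} then coef f S else 0)" using c by (intro ext) simp
qed

lemma bdeg_le_iff: "bdeg n f \<le> d \<longleftrightarrow> (\<forall>S\<in>supp {..<n} f. card S \<le> d)"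
proof -
  have "{card S | S. S \<subseteq> {..<n} \<and> mlcoef n f S \<noteq> 0} = card ` supp {..<n} f"
    by (auto simp: mlcoef_eq supp_def)
  thus ?thesis by (simp add: bdeg_def finite_supp)
qed

lemma relevant_vars_eq: "relevant_vars n f = \<Union>(supp {..<n} f)"
  unfolding relevant_vars_def supp_def by (simp add: mlcoef_eq cong: conj_cong)

text \<open>Every relevant variable weighs at least \<open>(1 / 2) ^ d\<close>, so the total weight
  bounds their number; 104 is 4 times 26.\<close>

lemma Rf_le:
  assumes "bdeg n f \<le> d"
  shows "real (Rf n f) \<le> 104 * 2 ^ d"
proof -
  let ?V = "{..<n}"
  have deg: "\<forall>S\<in>supp ?V f. card S \<le> d" using assms by (simp add: bdeg_le_iff)
  have "real (Rf n f) * (1 / 2) ^ d = (\<Sum>i\<in>\<Union>(supp ?V f). (1 / 2) ^ d)"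
    by (simp add: Rf_def relevant_vars_eq)
  also have "\<dots> \<le> (\<Sum>i\<in>\<Union>(supp ?V f). weight ?V f i)"
  proof (rule sum_mono)
    fix i assume "i \<in> \<Union>(supp ?V f)"
    then obtain S where "S \<in> supp ?V f" "weight ?V f i = (1 / 2) ^ card S"
      using weight_attained[of ?V i f] by auto
    thus "(1 / 2) ^ d \<le> weight ?V f i" using deg by (auto intro!: power_decreasing)
  qed
  also have "\<dots> \<le> total_weight ?V f"
    unfolding total_weight_def by (intro sum_mono2) (auto simp: supp_def weight_nonneg)
  also have "\<dots> \<le> 4 * (26 - (real d ^ 3 + 6 * real d ^ 2 + 18 * real d + 26) / 2 ^ d)"
    using deg by (intro total_weight_le) auto
  also have "\<dots> \<le> 104" by simp
  finally show ?thesis by (simp add: field_simps)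
qed

section \<open>Renaming variables and the doubling construction\<close>

lemma coef_reindex:
  assumes "finite S" "inj_on \<sigma> V"
  shows "coef (\<lambda>x. f {i\<in>V. \<sigma> i \<in> x}) S
    = (if S \<subseteq> \<sigma> ` V then coef f {i\<in>V. \<sigma> i \<in> S} else 0)"
proof (rule coef_unique[symmetric, OF assms(1) _ order.refl])
  fix x assume "x \<subseteq> S"
  hence x: "finite x" using assms(1) finite_subset by blast
  have "(\<Sum>T\<in>Pow x. if T \<subseteq> \<sigma> ` V then coef f {i\<in>V. \<sigma> i \<in> T} else 0)
      = (\<Sum>T\<in>Pow (x \<inter> \<sigma> ` V). coef f {i\<in>V. \<sigma> i \<in> T})"
    using x by (intro sum.mono_neutral_cong_right) auto
  \<comment> \<open>Injectivity makes image and preimage under \<open>\<sigma>\<close> inverse to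
    each other on these sets.\<close>
  also have "\<dots> = (\<Sum>R\<in>Pow {i\<in>V. \<sigma> i \<in> x}. coef f R)"
  proof (rule sum.reindex_bij_witness[of _ "image \<sigma>" "\<lambda>T. {i\<in>V. \<sigma> i \<in> T}"])
    fix R assume "R \<in> Pow {i\<in>V. \<sigma> i \<in> x}"
    thus "{i\<in>V. \<sigma> i \<in> \<sigma> ` R} = R" using assms(2) by (auto simp: inj_on_def)
  qed auto
  also have "\<dots> = of_bool (f {i\<in>V. \<sigma> i \<in> x})"
  proof (rule sum_coef)
    have "\<sigma> ` {i\<in>V. \<sigma> i \<in> x} \<subseteq> x" by auto
    moreover have "inj_on \<sigma> {i\<in>V. \<sigma> i \<in> x}" using assms(2) by (rule inj_on_subset) auto
    ultimately show "finite {i\<in>V. \<sigma> i \<in> x}" using x inj_on_finite by blast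
  qed
  finally show "(\<Sum>T\<in>Pow x. if T \<subseteq> \<sigma> ` V then coef f {i\<in>V. \<sigma> i \<in> T} else 0)
      = of_bool (f {i\<in>V. \<sigma> i \<in> x})" .
qed

lemma supp_reindex:
  assumes "finite W" "inj_on \<sigma> V" "\<sigma> ` V \<subseteq> W"
  shows "supp W (\<lambda>x. f {i\<in>V. \<sigma> i \<in> x}) = (\<lambda>T. \<sigma> ` T) ` supp V f"
proof (intro equalityI subsetI)
  fix S assume S: "S \<in> supp W (\<lambda>x. f {i\<in>V. \<sigma> i \<in> x})"
  hence "finite S" by (rule finite_mem_supp[OF assms(1)])
  hence "S \<subseteq> \<sigma> ` V" "coef f {i\<in>V. \<sigma> i \<in> S} \<noteq> 0"
    using S by (auto simp: supp_def coef_reindex[OF _ assms(2)] split: if_splits)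
  moreover from this have "S = \<sigma> ` {i\<in>V. \<sigma> i \<in> S}" by auto
  ultimately show "S \<in> (\<lambda>T. \<sigma> ` T) ` supp V f" by (auto simp: supp_def)
next
  fix S assume "S \<in> (\<lambda>T. \<sigma> ` T) ` supp V f"
  then obtain T where T: "S = \<sigma> ` T" "T \<subseteq> V" "coef f T \<noteq> 0" by (auto simp: supp_def)
  have "S \<subseteq> W" using T assms(3) by auto
  moreover from this have "finite S" using assms(1) finite_subset by blast
  moreover have "{i\<in>V. \<sigma> i \<in> S} = T" using T assms(2) by (auto simp: inj_on_def)
  ultimately show "S \<in> supp W (\<lambda>x. f {i\<in>V. \<sigma> i \<in> x})"
    using T by (auto simp: supp_def coef_reindex[OF _ assms(2)])
qed

text \<open>Variable \<open>2 * n\<close> selects one of two copies of \<open>f\<close> on disjoint sets of variables.\<close>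

lemma double_relevant_vars:
  assumes "bdeg n f \<le> d"
  obtains h where "bdeg (Suc (2 * n)) h \<le> Suc d" "Rf (Suc (2 * n)) h \<ge> 2 * Rf n f"
proof -
  let ?V = "{..<n}" and ?W = "{..<Suc (2 * n)}"
  \<comment> \<open>The unshifted copy uses the variables below \<open>n\<close>, the shifted one
    those from \<open>n\<close> to \<open>2 * n - 1\<close>.\<close>
  define h where "h x = (if 2 * n \<in> x then f {i\<in>?V. i \<in> x} else f {i\<in>?V. i + n \<in> x})" for x
  have h0: "(\<lambda>x. h (x - {2 * n})) = (\<lambda>x. f {i\<in>?V. i + n \<in> x})"
    unfolding h_def by (intro ext) (auto intro!: arg_cong[of _ _ f])
  have h1: "(\<lambda>x. h (insert (2 * n) x)) = (\<lambda>x. f {i\<in>?V. i \<in> x})"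
    unfolding h_def by (intro ext) (auto intro!: arg_cong[of _ _ f])
  have s0: "supp ?W (\<lambda>x. h (x - {2 * n})) = (\<lambda>T. (\<lambda>i. i + n) ` T) ` supp ?V f"
    unfolding h0 by (rule supp_reindex) (auto simp: inj_on_def)
  have s1: "supp ?W (\<lambda>x. h (insert (2 * n) x)) = (\<lambda>T. (\<lambda>i. i) ` T) ` supp ?V f"
    unfolding h1 by (rule supp_reindex) auto
  have deg: "card T \<le> d" if "T \<in> supp ?V f" for T using assms that by (simp add: bdeg_le_iff)
  have "card S \<le> Suc d" if S: "S \<in> supp ?W h" for S
  proof -
    \<comment> \<open>Without the selector, a monomial of \<open>h\<close> is one of a copy of
      \<open>f\<close>; the selector adds at most one to the degree.\<close>
    have "S - {2 * n} \<in> (\<lambda>T. (\<lambda>i. i + n) ` T) ` supp ?V f \<or> S - {2 * n} \<in> supp ?V f"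
      using mem_supp_imp_restrict[of ?W S h "2 * n"] S unfolding s0 s1 by auto
    hence "card (S - {2 * n}) \<le> d" using deg by (auto simp: card_image)
    moreover have "card S \<le> Suc (card (S - {2 * n}))"
      by (auto simp: card_Diff_singleton_if)
    ultimately show ?thesis by simp
  qed
  hence deg_h: "bdeg (Suc (2 * n)) h \<le> Suc d" by (simp add: bdeg_le_iff)
  let ?R = "\<Union>(supp ?V f)"
  have RV: "?R \<subseteq> ?V" by (auto simp: supp_def)
  \<comment> \<open>Variables relevant for a restriction of \<open>h\<close> are relevant for
    \<open>h\<close>, so both disjoint copies count in full.\<close>
  have "\<Union>(supp ?W (\<lambda>x. h (x - {2 * n}))) \<subseteq> \<Union>(supp ?W h)"
    using supp_restrict0(2)[of ?W _ h "2 * n"] by (intro Union_mono subsetI) simp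
  moreover have "(\<lambda>i. i + n) ` ?R = \<Union>(supp ?W (\<lambda>x. h (x - {2 * n})))" unfolding s0 by auto
  ultimately have sub0: "(\<lambda>i. i + n) ` ?R \<subseteq> \<Union>(supp ?W h)" by simp
  have "\<Union>(supp ?W (\<lambda>x. h (insert (2 * n) x))) \<subseteq> \<Union>(supp ?W h)"
  proof (rule Union_least)
    fix S assume "S \<in> supp ?W (\<lambda>x. h (insert (2 * n) x))"
    hence "S \<in> supp ?W h \<or> insert (2 * n) S \<in> supp ?W h"
      using supp_restrict1(2)[of ?W "2 * n" S h] by simp
    thus "S \<subseteq> \<Union>(supp ?W h)" by blast
  qed
  moreover have "?R = \<Union>(supp ?W (\<lambda>x. h (insert (2 * n) x)))" unfolding s1 by auto
  ultimately have sub1: "?R \<subseteq> \<Union>(supp ?W h)" by simp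
  have finR: "finite ?R" using RV finite_subset by blast
  have "2 * Rf n f = card ?R + card ((\<lambda>i. i + n) ` ?R)"
    by (simp add: Rf_def relevant_vars_eq card_image)
  also have "\<dots> = card (?R \<union> (\<lambda>i. i + n) ` ?R)"
    using RV finR by (intro card_Un_disjoint[symmetric]) fastforce+
  also have "\<dots> \<le> card (\<Union>(supp ?W h))"
    using sub0 sub1 by (intro card_mono) (auto intro: finite_subset[of _ ?W] simp: supp_def)
  finally have "2 * Rf n f \<le> Rf (Suc (2 * n)) h" by (simp add: Rf_def relevant_vars_eq)
  with deg_h show ?thesis using that by blast
qed

section \<open>Bounds and monotonicity for the suprema\<close>

lemma Rdeg_set_nonempty: "{real (Rf n f) | n f. bdeg n f \<le> d} \<noteq> {}"
proof -
  have "bdeg 0 f \<le> d" for f by (simp add: bdeg_le_iff supp_def)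
  thus ?thesis by blast
qed

text \<open>A real \<open>Sup\<close> is known to dominate its set only if the set is bounded above,
  which \<open>Rf_le\<close> provides.\<close>

lemma Rf_le_Rdeg:
  assumes "bdeg n f \<le> d"
  shows "real (Rf n f) \<le> Rdeg d"
  unfolding Rdeg_def
  by (rule cSup_upper) (use assms Rf_le in \<open>auto simp: bdd_above_def\<close>)

lemma Cdeg_le: "Cdeg d \<le> 104"
proof -
  have "Rdeg d \<le> 104 * 2 ^ d"
    unfolding Rdeg_def using Rdeg_set_nonempty Rf_le by (intro cSup_least) auto
  thus ?thesis by (simp add: Cdeg_def field_simps)
qed

text \<open>Doubling raises the degree by at most one while at least doubling the relevant
  variables, which offsets the extra factor 2 in the denominator.\<close>

lemma incseq_Cdeg: "incseq Cdeg"
proof (rule incseq_SucI)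
  fix d
  have "Rdeg d \<le> Rdeg (Suc d) / 2"
    unfolding Rdeg_def[of d]
  proof (rule cSup_least[OF Rdeg_set_nonempty])
    fix r assume "r \<in> {real (Rf n f) | n f. bdeg n f \<le> d}"
    then obtain n f where r: "r = real (Rf n f)" "bdeg n f \<le> d" by auto
    obtain h where "bdeg (Suc (2 * n)) h \<le> Suc d" "Rf (Suc (2 * n)) h \<ge> 2 * Rf n f"
      using double_relevant_vars[OF r(2)] .
    thus "r \<le> Rdeg (Suc d) / 2" using Rf_le_Rdeg[of "Suc (2 * n)" h "Suc d"] r(1) by linarith
  qed
  thus "Cdeg d \<le> Cdeg (Suc d)" by (simp add: Cdeg_def field_simps)
qed

theorem theorem1:
  shows "\<exists>C::real. C > 0 \<and>
    (\<forall>(n::nat) (f::nat set \<Rightarrow> bool). real (Rf n f) * 2 powr (- real (bdeg n f)) \<le> C) \<and>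
    (\<forall>d. Cdeg d \<le> C) \<and> convergent Cdeg"
proof (intro exI[of _ 104] conjI allI)
  show "real (Rf n f) * 2 powr (- real (bdeg n f)) \<le> 104" for n f
    using Rf_le[OF order.refl, of n f] by (simp add: powr_minus powr_realpow field_simps)
  show "Cdeg d \<le> 104" for d by (rule Cdeg_le)
  \<comment> \<open>A nondecreasing sequence bounded by 104 converges.\<close>
  show "convergent Cdeg"
    using incseq_convergent[OF incseq_Cdeg] Cdeg_le convergentI by metis
qed simp

end
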